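(* Let $\varphi\in\mathrm{FO}[\exists^{(q,p)}x]$ be a formula of quantifier depth $d$. Then there exists a Boolean combination $\gamma$ of atomic formulas that is equivalent to $\varphi$ and satisfies \[\max\mathbf{P}(\gamma)\le\max\mathbf{P}(\varphi)^{4^d}\quad\text{and}\quad \max\textsc{Const}(\gamma)\le 2^{(\max\mathbf{P}(\varphi))^{4^d}}\cdot\max\textsc{Const}(\varphi).\]
   Context: Formulas are interpreted over $\mathbb{Z}$ with all integer constants, $+$, $<$ and $\equiv_k$ ($k\ge2$; $m\equiv_k n$ iff $k\mid m-n$). Terms are built from variables and integer constants by addition and multiplication by integers; each term has a unique normal form $a_1x_{i_1}+\dots+a_nx_{i_n}+c$ with $i_1<\dots<i_n$ and $a_j\ne0$ (coefficients $a_j$, constant $c$). Atomic formulas: $s<t$, $s\equiv_k t$ ($k\ge1$). Formulas of $\mathrm{FO}[\exists^{(q,p)}x]$ are built from atomic formulas with $\neg,\land,\lor,\to,\leftrightarrow$, $\exists y$, and $\exists^{(q,p)}y$ ($y$ a single variable, $q$ a natural number, $p\ge2$); $\exists^{(q,p)}y\,\varphi$ holds under an assignment iff the set of integers $a$ such that $\varphi$ holds with $y$ set to $a$ is finite and its cardinality is congruent to $q$ modulo $p$. A Boolean combination of atomic formulas is built from atomic formulas using only $\neg,\land,\lor,\to,\leftrightarrow$. Two formulas are equivalent if they have the same truth value under every assignment. Quantifier depth: $0$ for atomic formulas, unchanged by $\neg$, maximum for binary connectives, plus one for each quantifier. $\textsc{Coeff}(\varphi)$ consists of $0,\pm1,\pm2$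 and all $\pm a$ with $a$ a coefficient in the normal form of $s_1-s_2$ for an atomic subformula $s_1<s_2$ of $\varphi$; $\textsc{Const}(\varphi)$ consists of $0,\pm1,\pm2$ and all $\pm c$ with $c$ the constant of $s_1-s_2$ for such a subformula; $\textsc{Mod}(\varphi)$ consists of $1$ and all $k$ such that an atomic subformula $s_1\equiv_k s_2$ or a quantifier $\exists^{(q,k)}$ occurs in $\varphi$; $\mathbf{P}(\varphi)=\textsc{Coeff}(\varphi)\cup\textsc{Mod}(\varphi)$. *)

theory Defs
  imports "HOL-Number_Theory.Cong"
begin

section \<open>Terms\<close>

datatype tm =
    Var nat
  | Cst int
  | Add tm tm
  | Mul int tm

primrec eval :: "(nat \<Rightarrow> int) \<Rightarrow> tm \<Rightarrow> int" where
  "eval v (Var i) = v i"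
| "eval v (Cst c) = c"
| "eval v (Add s t) = eval v s + eval v t"
| "eval v (Mul a t) = a * eval v t"

definition Sub :: "tm \<Rightarrow> tm \<Rightarrow> tm" where
  "Sub s t = Add s (Mul (- 1) t)"

text \<open>The normal form \<open>a\<^sub>1 x\<^sub>i\<^sub>1 + \<dots> + a\<^sub>n x\<^sub>i\<^sub>n + c\<close> of a term is given by the factor
  \<open>var_coeff t i\<close> of every variable \<open>i\<close> (0 if the variable is absent from the normal form) and by
  the constant \<open>nf_const t\<close>; see \<open>eval_normal_form\<close> and \<open>normal_form_unique\<close> below.\<close>

primrec var_coeff :: "tm \<Rightarrow> nat \<Rightarrow> int" where
  "var_coeff (Var i) j = (if i = j then 1 else 0)"
| "var_coeff (Cst c) j = 0"
| "var_coeff (Add s t) j = var_coeff s j + var_coeff t j"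
| "var_coeff (Mul a t) j = a * var_coeff t j"

primrec nf_const :: "tm \<Rightarrow> int" where
  "nf_const (Var i) = 0"
| "nf_const (Cst c) = c"
| "nf_const (Add s t) = nf_const s + nf_const t"
| "nf_const (Mul a t) = a * nf_const t"

definition nf_vars :: "tm \<Rightarrow> nat set" where
  "nf_vars t = {i. var_coeff t i \<noteq> 0}"

definition nf_coeffs :: "tm \<Rightarrow> int set" where
  "nf_coeffs t = var_coeff t ` nf_vars t"

primrec vars :: "tm \<Rightarrow> nat set" where
  "vars (Var i) = {i}"
| "vars (Cst c) = {}"
| "vars (Add s t) = vars s \<union> vars t"
| "vars (Mul a t) = vars t"

lemma finite_vars: "finite (vars t)"
  by (induction t) auto

lemma nf_vars_subset_vars: "nf_vars t \<subseteq> vars t"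
proof -
  have "i \<notin> vars t \<Longrightarrow> var_coeff t i = 0" for i
    by (induction t) auto
  then show ?thesis by (auto simp: nf_vars_def)
qed

lemma finite_nf_vars: "finite (nf_vars t)"
  using finite_vars nf_vars_subset_vars by (rule finite_subset[rotated])

lemma eval_eq_sum:
  assumes "finite I" "vars t \<subseteq> I"
  shows "eval v t = (\<Sum>i\<in>I. var_coeff t i * v i) + nf_const t"
  using assms
proof (induction t)
  case (Var i)
  have "(\<Sum>j\<in>I. (if i = j then 1 else 0) * v j) = (\<Sum>j\<in>I. if i = j then v j else 0)"
    by (rule sum.cong) auto
  with Var show ?case by simp
next
  case (Add s t)
  then show ?case by (simp add: sum.distrib distrib_right)
next
  case (Mul a t)
  then show ?case by (simp add: sum_distrib_left distrib_left mult.assoc)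
qed simp

lemma eval_normal_form: "eval v t = (\<Sum>i\<in>nf_vars t. var_coeff t i * v i) + nf_const t"
proof -
  have "(\<Sum>i\<in>vars t. var_coeff t i * v i) = (\<Sum>i\<in>nf_vars t. var_coeff t i * v i)"
    using finite_vars nf_vars_subset_vars
    by (intro sum.mono_neutral_right) (auto simp: nf_vars_def)
  then show ?thesis using eval_eq_sum[OF finite_vars order.refl, of v t] by simp
qed

lemma normal_form_unique:
  assumes fin: "finite {i. a i \<noteq> 0}"
    and eq: "\<And>v. eval v t = (\<Sum>i | a i \<noteq> 0. a i * v i) + c"
  shows "a = var_coeff t" "c = nf_const t"
proof -
  show c: "c = nf_const t"
    using eq[of "\<lambda>_. 0"] eval_normal_form[of "\<lambda>_. 0" t] by simp
  show "a = var_coeff t"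
  proof
    fix j
    have sum_at: "(\<Sum>i\<in>I. f i * (if i = j then 1 else 0)) = f j"
      if "finite I" "I = {i. f i \<noteq> 0}" for I and f :: "nat \<Rightarrow> int"
    proof -
      have "(\<Sum>i\<in>I. f i * (if i = j then 1 else 0)) = (\<Sum>i\<in>I. if i = j then f i else 0)"
        by (rule sum.cong) auto
      with that show ?thesis by simp
    qed
    show "a j = var_coeff t j"
      using eq[of "\<lambda>i. if i = j then 1 else 0"]
        eval_normal_form[of "\<lambda>i. if i = j then 1 else 0" t]
        sum_at[OF fin refl] sum_at[OF finite_nf_vars nf_vars_def, of t] c
      by simp
  qed
qed

section \<open>Formulas\<close>

text \<open>\<open>ExMod q p y \<phi>\<close> is the modulo-counting quantifier \<open>\<exists>\<^sup>(\<^sup>q\<^sup>,\<^sup>p\<^sup>) y. \<phi>\<close>. The side conditions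
  \<open>k \<ge> 1\<close> on congruences and \<open>p \<ge> 2\<close> on quantifiers are imposed by \<open>FO_mod\<close> and
  \<open>boolean_combination\<close>.\<close>

datatype fm =
    Less tm tm
  | Congr nat tm tm
  | Neg fm
  | And fm fm
  | Or fm fm
  | Imp fm fm
  | Iff fm fm
  | Ex nat fm
  | ExMod nat nat nat fm

primrec FO_mod :: "fm \<Rightarrow> bool" where
  "FO_mod (Less s t) \<longleftrightarrow> True"
| "FO_mod (Congr k s t) \<longleftrightarrow> k \<ge> 1"
| "FO_mod (Neg \<phi>) \<longleftrightarrow> FO_mod \<phi>"
| "FO_mod (And \<phi> \<psi>) \<longleftrightarrow> FO_mod \<phi> \<and> FO_mod \<psi>"
| "FO_mod (Or \<phi> \<psi>) \<longleftrightarrow> FO_mod \<phi> \<and> FO_mod \<psi>"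
| "FO_mod (Imp \<phi> \<psi>) \<longleftrightarrow> FO_mod \<phi> \<and> FO_mod \<psi>"
| "FO_mod (Iff \<phi> \<psi>) \<longleftrightarrow> FO_mod \<phi> \<and> FO_mod \<psi>"
| "FO_mod (Ex y \<phi>) \<longleftrightarrow> FO_mod \<phi>"
| "FO_mod (ExMod q p y \<phi>) \<longleftrightarrow> p \<ge> 2 \<and> FO_mod \<phi>"

primrec boolean_combination :: "fm \<Rightarrow> bool" where
  "boolean_combination (Less s t) \<longleftrightarrow> True"
| "boolean_combination (Congr k s t) \<longleftrightarrow> k \<ge> 1"
| "boolean_combination (Neg \<phi>) \<longleftrightarrow> boolean_combination \<phi>"
| "boolean_combination (And \<phi> \<psi>) \<longleftrightarrow> boolean_combination \<phi> \<and> boolean_combination \<psi>"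
| "boolean_combination (Or \<phi> \<psi>) \<longleftrightarrow> boolean_combination \<phi> \<and> boolean_combination \<psi>"
| "boolean_combination (Imp \<phi> \<psi>) \<longleftrightarrow> boolean_combination \<phi> \<and> boolean_combination \<psi>"
| "boolean_combination (Iff \<phi> \<psi>) \<longleftrightarrow> boolean_combination \<phi> \<and> boolean_combination \<psi>"
| "boolean_combination (Ex y \<phi>) \<longleftrightarrow> False"
| "boolean_combination (ExMod q p y \<phi>) \<longleftrightarrow> False"

primrec sat :: "(nat \<Rightarrow> int) \<Rightarrow> fm \<Rightarrow> bool" where
  "sat v (Less s t) \<longleftrightarrow> eval v s < eval v t"
| "sat v (Congr k s t) \<longleftrightarrow> [eval v s = eval v t] (mod int k)"
| "sat v (Neg \<phi>) \<longleftrightarrow> \<not> sat v \<phi>"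
| "sat v (And \<phi> \<psi>) \<longleftrightarrow> sat v \<phi> \<and> sat v \<psi>"
| "sat v (Or \<phi> \<psi>) \<longleftrightarrow> sat v \<phi> \<or> sat v \<psi>"
| "sat v (Imp \<phi> \<psi>) \<longleftrightarrow> (sat v \<phi> \<longrightarrow> sat v \<psi>)"
| "sat v (Iff \<phi> \<psi>) \<longleftrightarrow> (sat v \<phi> \<longleftrightarrow> sat v \<psi>)"
| "sat v (Ex y \<phi>) \<longleftrightarrow> (\<exists>a. sat (v(y := a)) \<phi>)"
| "sat v (ExMod q p y \<phi>) \<longleftrightarrow>
     finite {a. sat (v(y := a)) \<phi>} \<and> [card {a. sat (v(y := a)) \<phi>} = q] (mod p)"

definition equivalent :: "fm \<Rightarrow> fm \<Rightarrow> bool" where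
  "equivalent \<phi> \<psi> \<longleftrightarrow> (\<forall>v. sat v \<phi> \<longleftrightarrow> sat v \<psi>)"

primrec qdepth :: "fm \<Rightarrow> nat" where
  "qdepth (Less s t) = 0"
| "qdepth (Congr k s t) = 0"
| "qdepth (Neg \<phi>) = qdepth \<phi>"
| "qdepth (And \<phi> \<psi>) = max (qdepth \<phi>) (qdepth \<psi>)"
| "qdepth (Or \<phi> \<psi>) = max (qdepth \<phi>) (qdepth \<psi>)"
| "qdepth (Imp \<phi> \<psi>) = max (qdepth \<phi>) (qdepth \<psi>)"
| "qdepth (Iff \<phi> \<psi>) = max (qdepth \<phi>) (qdepth \<psi>)"
| "qdepth (Ex y \<phi>) = qdepth \<phi> + 1"
| "qdepth (ExMod q p y \<phi>) = qdepth \<phi> + 1"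

primrec subformulas :: "fm \<Rightarrow> fm set" where
  "subformulas (Less s t) = {Less s t}"
| "subformulas (Congr k s t) = {Congr k s t}"
| "subformulas (Neg \<phi>) = insert (Neg \<phi>) (subformulas \<phi>)"
| "subformulas (And \<phi> \<psi>) = insert (And \<phi> \<psi>) (subformulas \<phi> \<union> subformulas \<psi>)"
| "subformulas (Or \<phi> \<psi>) = insert (Or \<phi> \<psi>) (subformulas \<phi> \<union> subformulas \<psi>)"
| "subformulas (Imp \<phi> \<psi>) = insert (Imp \<phi> \<psi>) (subformulas \<phi> \<union> subformulas \<psi>)"
| "subformulas (Iff \<phi> \<psi>) = insert (Iff \<phi> \<psi>) (subformulas \<phi> \<union> subformulas \<psi>)"
| "subformulas (Ex y \<phi>) = insert (Ex y \<phi>) (subformulas \<phi>)"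
| "subformulas (ExMod q p y \<phi>) = insert (ExMod q p y \<phi>) (subformulas \<phi>)"

section \<open>Parameters of a formula\<close>

definition Coeff :: "fm \<Rightarrow> int set" where
  "Coeff \<phi> = {0, 1, - 1, 2, - 2} \<union>
     (\<Union>{nf_coeffs (Sub s t) \<union> uminus ` nf_coeffs (Sub s t) | s t. Less s t \<in> subformulas \<phi>})"

definition Const :: "fm \<Rightarrow> int set" where
  "Const \<phi> = {0, 1, - 1, 2, - 2} \<union>
     (\<Union>{{nf_const (Sub s t), - nf_const (Sub s t)} | s t. Less s t \<in> subformulas \<phi>})"

definition Mod :: "fm \<Rightarrow> nat set" where
  "Mod \<phi> = {1} \<union> {k. \<exists>s t. Congr k s t \<in> subformulas \<phi>}
     \<union> {k. \<exists>q y \<psi>. ExMod q k y \<psi> \<in> subformulas \<phi>}"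

definition Params :: "fm \<Rightarrow> int set" where
  "Params \<phi> = Coeff \<phi> \<union> int ` Mod \<phi>"

text \<open>These sets are finite (and nonempty), so \<open>Max\<close> is meaningful on them.\<close>

lemma finite_subformulas: "finite (subformulas \<phi>)"
  by (induction \<phi>) auto

lemma finite_Coeff: "finite (Coeff \<phi>)"
proof -
  let ?g = "\<lambda>\<psi>. case \<psi> of Less s t \<Rightarrow> nf_coeffs (Sub s t) \<union> uminus ` nf_coeffs (Sub s t) | _ \<Rightarrow> {}"
  have "Coeff \<phi> \<subseteq> {0, 1, - 1, 2, - 2} \<union> (\<Union>\<psi>\<in>subformulas \<phi>. ?g \<psi>)"
    unfolding Coeff_def by (force split: fm.splits)
  moreover have "finite (?g \<psi>)" for \<psi>
    by (simp add: nf_coeffs_def finite_nf_vars split: fm.split)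
  ultimately show ?thesis
    by (auto intro: finite_subset simp: finite_subformulas)
qed

lemma finite_Const: "finite (Const \<phi>)"
proof -
  let ?g = "\<lambda>\<psi>. case \<psi> of Less s t \<Rightarrow> {nf_const (Sub s t), - nf_const (Sub s t)} | _ \<Rightarrow> {}"
  have "Const \<phi> \<subseteq> {0, 1, - 1, 2, - 2} \<union> (\<Union>\<psi>\<in>subformulas \<phi>. ?g \<psi>)"
    unfolding Const_def by (force split: fm.splits)
  moreover have "finite (?g \<psi>)" for \<psi>
    by (simp split: fm.split)
  ultimately show ?thesis
    by (auto intro: finite_subset simp: finite_subformulas)
qed

lemma finite_Mod: "finite (Mod \<phi>)"
proof -
  let ?g = "\<lambda>\<psi>. case \<psi> of Congr k s t \<Rightarrow> {k} | ExMod q k y \<psi> \<Rightarrow> {k} | _ \<Rightarrow> {}"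
  have "Mod \<phi> \<subseteq> {1} \<union> (\<Union>\<psi>\<in>subformulas \<phi>. ?g \<psi>)"
    unfolding Mod_def by (force split: fm.splits)
  moreover have "finite (?g \<psi>)" for \<psi>
    by (simp split: fm.split)
  ultimately show ?thesis
    by (auto intro: finite_subset simp: finite_subformulas)
qed

lemma finite_Params: "finite (Params \<phi>)"
  by (simp add: Params_def finite_Coeff finite_Mod)

lemma Max_Params_ge: "Max (Params \<phi>) \<ge> 2"
  by (rule Max_ge[OF finite_Params]) (simp add: Params_def Coeff_def)

lemma Max_Const_ge: "Max (Const \<phi>) \<ge> 2"
  by (rule Max_ge[OF finite_Const]) (simp add: Const_def)

end

theory Submission
  imports Defs "HOL-Library.Disjoint_Sets"
begin

text \<open>The proof is an Ehrenfeucht--Fraisse argument instead of a syntactic elimination. Call two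
  assignments indistinguishable at level \<open>(P, C)\<close> if they satisfy the same inequalities with
  coefficients at most \<open>P\<close> and constant at most \<open>C\<close>, and agree modulo all numbers up to \<open>P\<close>. If two
  assignments are indistinguishable at level \<open>(P ^ 4, C')\<close> with \<open>C'\<close> exponentially larger than \<open>C\<close>,
  then for every property that is invariant at level \<open>(P, C)\<close> the sets of values of \<open>y\<close> with this
  property are both empty or both nonempty, both finite or both infinite, and of equal cardinality
  modulo every \<open>p \<le> P\<close>. Indeed the type of a value \<open>y\<close> is given by its position relative to the
  integer cut points \<open>s div b\<close> and its residue modulo \<open>Lcm {1..P}\<close>, and the order of the cut points,
  their small differences and their residues modulo \<open>p * Lcm {1..P}\<close> are visible at the higher level.
  By induction the truth of \<open>\<phi>\<close> depends only on the level \<open>P ^ 4 ^ d\<close> atoms, so it is a Boolean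
  combination of these finitely many atoms.\<close>

section \<open>Counting modulo \<open>p\<close> between cut points\<close>

text \<open>Emptiness decides \<open>Ex\<close>; finiteness and the congruence decide
  \<open>ExMod\<close> for every remainder. As \<open>card\<close> is 0 on infinite sets, the
  congruence holds by itself when both sets are infinite.\<close>

definition same_size :: "nat \<Rightarrow> 'a set \<Rightarrow> 'b set \<Rightarrow> bool" where
  "same_size p S S' \<longleftrightarrow>
     (S = {} \<longleftrightarrow> S' = {}) \<and> (finite S \<longleftrightarrow> finite S') \<and> [card S = card S'] (mod p)"

lemma same_size_UN:
  assumes "finite I" and "disjoint_family_on S I" "disjoint_family_on S' I"
    and "\<And>i. i \<in> I \<Longrightarrow> same_size p (S i) (S' i)"
  shows "same_size p (\<Union>i\<in>I. S i) (\<Union>i\<in>I. S' i)"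
proof -
  have fin: "finite (\<Union>i\<in>I. S i) \<longleftrightarrow> finite (\<Union>i\<in>I. S' i)"
    using assms by (auto simp: same_size_def)
  have "[card (\<Union>i\<in>I. S i) = card (\<Union>i\<in>I. S' i)] (mod p)"
  proof (cases "finite (\<Union>i\<in>I. S i)")
    case True
    with fin have fin1: "\<forall>i\<in>I. finite (S i)" "\<forall>i\<in>I. finite (S' i)"
      using assms(1) by auto
    have "card (\<Union>i\<in>I. S i) = (\<Sum>i\<in>I. card (S i))"
      using assms fin1 by (intro card_UN_disjoint) (auto simp: disjoint_family_on_def)
    moreover have "card (\<Union>i\<in>I. S' i) = (\<Sum>i\<in>I. card (S' i))"
      using assms fin1 by (intro card_UN_disjoint) (auto simp: disjoint_family_on_def)
    moreover have "[(\<Sum>i\<in>I. card (S i)) = (\<Sum>i\<in>I. card (S' i))] (mod p)"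
      using assms(4) by (intro cong_sum) (auto simp: same_size_def)
    ultimately show ?thesis by simp
  next
    case False
    with fin show ?thesis by simp
  qed
  with fin show ?thesis
    using assms(4) by (auto simp: same_size_def)
qed

lemma same_size_inj_image:
  assumes "inj f" "inj g" "same_size p S S'"
  shows "same_size p (f ` S) (g ` S')"
proof -
  have "inj_on f S" "inj_on g S'" using assms inj_on_subset by blast+
  with assms(3) show ?thesis
    by (simp add: same_size_def finite_image_iff card_image)
qed

text \<open>For \<open>K\<close> inside \<open>J\<close> the cell is the interval between the
  greatest cut point outside \<open>K\<close> and the least one in \<open>K\<close>. Equal order
  makes the same indices extremal in both families, so the two intervals are empty together and
  their lengths agree modulo \<open>p\<close>; a missing end makes both infinite.\<close>

lemma same_size_cut_cell:
  fixes \<alpha> \<alpha>' :: "'j \<Rightarrow> int"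
  assumes fin: "finite J"
    and ord: "\<And>j k. j \<in> J \<Longrightarrow> k \<in> J \<Longrightarrow> \<alpha> j < \<alpha> k \<longleftrightarrow> \<alpha>' j < \<alpha>' k"
    and cong: "\<And>j. j \<in> J \<Longrightarrow> [\<alpha> j = \<alpha>' j] (mod int p)"
  shows "same_size p {x. {j \<in> J. x \<le> \<alpha> j} = K} {x. {j \<in> J. x \<le> \<alpha>' j} = K}"
proof (cases "K \<subseteq> J")
  case False
  then have "{x. {j \<in> J. x \<le> \<beta> j} = K} = {}" for \<beta> :: "'j \<Rightarrow> int" by auto
  then show ?thesis by (simp add: same_size_def)
next
  case True
  have cell: "{x. {j \<in> J. x \<le> \<beta> j} = K} = {x. (\<forall>j\<in>K. x \<le> \<beta> j) \<and> (\<forall>j\<in>J-K. \<beta> j < x)}"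
    for \<beta> :: "'j \<Rightarrow> int" using True by (force simp: not_le)
  have least: "\<exists>k\<in>K. (\<forall>j\<in>K. \<alpha> k \<le> \<alpha> j) \<and> (\<forall>j\<in>K. \<alpha>' k \<le> \<alpha>' j)" if "K \<noteq> {}"
  proof -
    have "finite (\<alpha> ` K)" using True fin finite_subset by blast
    then have "Min (\<alpha> ` K) \<in> \<alpha> ` K" using that by (intro Min_in) auto
    then obtain k where k: "k \<in> K" "Min (\<alpha> ` K) = \<alpha> k" by auto
    then have "\<forall>j\<in>K. \<alpha> k \<le> \<alpha> j"
      by (metis Min_le \<open>finite (\<alpha> ` K)\<close> imageI)
    then show ?thesis using k True ord by (metis not_le subsetD)
  qed
  have greatest: "\<exists>k\<in>J-K. (\<forall>j\<in>J-K. \<alpha> j \<le> \<alpha> k) \<and> (\<forall>j\<in>J-K. \<alpha>' j \<le> \<alpha>' k)" if "J - K \<noteq> {}"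
  proof -
    have "finite (\<alpha> ` (J - K))" using fin by blast
    then have "Max (\<alpha> ` (J - K)) \<in> \<alpha> ` (J - K)" using that by (intro Max_in) auto
    then obtain k where k: "k \<in> J - K" "Max (\<alpha> ` (J - K)) = \<alpha> k" by auto
    then have "\<forall>j\<in>J-K. \<alpha> j \<le> \<alpha> k"
      by (metis Max_ge \<open>finite (\<alpha> ` (J - K))\<close> imageI)
    then show ?thesis using k True ord by (metis not_le DiffD1)
  qed
  consider "K = {}" "J - K = {}" | "K = {}" "J - K \<noteq> {}" | "K \<noteq> {}" "J - K = {}"
    | "K \<noteq> {}" "J - K \<noteq> {}" by blast
  then show ?thesis
  proof cases
    case 1
    then show ?thesis unfolding cell by (simp add: same_size_def)
  next
    case 2
    from greatest[OF 2(2)] obtain k where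
      k: "k \<in> J - K" "\<forall>j\<in>J-K. \<alpha> j \<le> \<alpha> k" "\<forall>j\<in>J-K. \<alpha>' j \<le> \<alpha>' k" by blast
    have "{x. (\<forall>j\<in>K. x \<le> \<alpha> j) \<and> (\<forall>j\<in>J-K. \<alpha> j < x)} = {\<alpha> k<..}"
      "{x. (\<forall>j\<in>K. x \<le> \<alpha>' j) \<and> (\<forall>j\<in>J-K. \<alpha>' j < x)} = {\<alpha>' k<..}"
      using k 2(1) by fastforce+
    then show ?thesis unfolding cell by (simp add: same_size_def infinite_Ioi)
  next
    case 3
    from least[OF 3(1)] obtain k where
      k: "k \<in> K" "\<forall>j\<in>K. \<alpha> k \<le> \<alpha> j" "\<forall>j\<in>K. \<alpha>' k \<le> \<alpha>' j" by blast
    have "{x. (\<forall>j\<in>K. x \<le> \<alpha> j) \<and> (\<forall>j\<in>J-K. \<alpha> j < x)} = {..\<alpha> k}"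
      "{x. (\<forall>j\<in>K. x \<le> \<alpha>' j) \<and> (\<forall>j\<in>J-K. \<alpha>' j < x)} = {..\<alpha>' k}"
      using k 3(2) by fastforce+
    then show ?thesis unfolding cell by (simp add: same_size_def infinite_Iic)
  next
    case 4
    from least[OF 4(1)] obtain k where
      k: "k \<in> K" "\<forall>j\<in>K. \<alpha> k \<le> \<alpha> j" "\<forall>j\<in>K. \<alpha>' k \<le> \<alpha>' j" by blast
    from greatest[OF 4(2)] obtain l where
      l: "l \<in> J - K" "\<forall>j\<in>J-K. \<alpha> j \<le> \<alpha> l" "\<forall>j\<in>J-K. \<alpha>' j \<le> \<alpha>' l" by blast
    have eqs: "{x. (\<forall>j\<in>K. x \<le> \<alpha> j) \<and> (\<forall>j\<in>J-K. \<alpha> j < x)} = {\<alpha> l<..\<alpha> k}"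
      "{x. (\<forall>j\<in>K. x \<le> \<alpha>' j) \<and> (\<forall>j\<in>J-K. \<alpha>' j < x)} = {\<alpha>' l<..\<alpha>' k}"
      using k(1,2) l(1,2) k(3) l(3) by (auto intro: order.trans le_less_trans)
    have lk: "\<alpha> l < \<alpha> k \<longleftrightarrow> \<alpha>' l < \<alpha>' k" using ord k l True by blast
    have "[\<alpha> k - \<alpha> l = \<alpha>' k - \<alpha>' l] (mod int p)"
      using cong k l True by (intro cong_diff) auto
    \<comment> \<open>Truncation by \<open>nat\<close> gives an empty interval the length 0; by
      \<open>lk\<close> this happens on both sides at once.\<close>
    then have "[nat (\<alpha> k - \<alpha> l) = nat (\<alpha>' k - \<alpha>' l)] (mod p)"
      using lk by (cases "\<alpha> l < \<alpha> k") (auto simp flip: cong_int_iff)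
    with lk show ?thesis unfolding cell eqs by (auto simp: same_size_def not_le not_less)
  qed
qed

lemma le_div_iff_mult_le:
  fixes b x s :: int
  assumes "b > 0"
  shows "x \<le> s div b \<longleftrightarrow> b * x \<le> s"
proof
  assume "x \<le> s div b"
  then have "b * x \<le> b * (s div b)" using assms by simp
  also have "\<dots> \<le> s" using assms
    by (metis add_le_cancel_left add.right_neutral mult_div_mod_eq pos_mod_sign)
  finally show "b * x \<le> s" .
next
  assume "b * x \<le> s"
  then have "b * x div b \<le> s div b" using assms by (intro zdiv_mono1)
  then show "x \<le> s div b" using assms by simp
qed

lemma residue_class_eq_image:
  fixes L r :: int
  assumes "0 \<le> r" "r < L"
  shows "{x. Q x \<and> x mod L = r} = (\<lambda>k. L * k + r) ` {k. Q (L * k + r)}"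
proof -
  have "x \<in> (\<lambda>k. L * k + r) ` {k. Q (L * k + r)}" if "Q x" "x mod L = r" for x
  proof -
    have "x = L * (x div L) + r" using that(2) mult_div_mod_eq[of L x] by simp
    with that(1) show ?thesis by (intro image_eqI[of _ _ "x div L"]) auto
  qed
  with assms show ?thesis by auto
qed

text \<open>Writing \<open>x = L * k + r\<close> turns \<open>x \<le> w j\<close> into
  \<open>k \<le> (w j - r) div L\<close>, which reduces the claim to
  \<open>same_size_cut_cell\<close> for these quotients. Congruence modulo \<open>L * p\<close> of
  the cut points becomes congruence modulo \<open>p\<close> of the quotients.\<close>

lemma same_size_residue_cut_cell:
  fixes w w' :: "'j \<Rightarrow> int" and L r :: int
  assumes fin: "finite J" and r: "0 \<le> r" "r < L" and p: "p > 0"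
    and diff: "\<And>j k e. j \<in> J \<Longrightarrow> k \<in> J \<Longrightarrow> 0 \<le> e \<Longrightarrow> e \<le> L \<Longrightarrow>
      w j \<le> w k + e \<longleftrightarrow> w' j \<le> w' k + e"
    and cong: "\<And>j. j \<in> J \<Longrightarrow> [w j = w' j] (mod L * int p)"
  shows "same_size p {x. {j \<in> J. x \<le> w j} = K \<and> x mod L = r}
    {x. {j \<in> J. x \<le> w' j} = K \<and> x mod L = r}"
proof -
  define \<alpha> where "\<alpha> j = (w j - r) div L" for j
  define \<alpha>' where "\<alpha>' j = (w' j - r) div L" for j
  have L: "L > 0" using r by simp
  have shift: "\<exists>m. w' j = w j + L * int p * m \<and> \<alpha>' j = \<alpha> j + int p * m" if j: "j \<in> J" for j
  proof -
    from cong[OF j] obtain m where m: "w' j = w j + L * int p * m"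
      by (metis cong_iff_lin mult.commute)
    have "w' j - r = (w j - r) + L * (int p * m)" using m by (simp add: algebra_simps)
    then have "\<alpha>' j = \<alpha> j + int p * m"
      using L unfolding \<alpha>_def \<alpha>'_def by (metis add.commute div_mult_self2 less_irrefl)
    with m show ?thesis by blast
  qed
  have ord: "\<alpha> j < \<alpha> k \<longleftrightarrow> \<alpha>' j < \<alpha>' k" if jk: "j \<in> J" "k \<in> J" for j k
  proof -
    \<comment> \<open>Rounding is monotone, and a gap of at least \<open>L\<close> stays strict
      after division. Only smaller gaps need the congruences.\<close>
    consider "w k \<le> w j" | "w j + L \<le> w k" | "w j < w k" "w k < w j + L" by linarith
    then show ?thesis
    proof cases
      case 1
      then have "w' k \<le> w' j" using diff[of k j 0] jk L by simp
      with 1 have "\<alpha> k \<le> \<alpha> j" "\<alpha>' k \<le> \<alpha>' j"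
        unfolding \<alpha>_def \<alpha>'_def using L by (auto intro!: zdiv_mono1)
      then show ?thesis by simp
    next
      case 2
      then have "w' j + L \<le> w' k" using diff[of k j "L - 1"] jk L by simp
      then have "(w' j - r + L) div L \<le> \<alpha>' k"
        unfolding \<alpha>'_def using L by (intro zdiv_mono1) auto
      moreover have "(w j - r + L) div L \<le> \<alpha> k"
        unfolding \<alpha>_def using L 2 by (intro zdiv_mono1) auto
      ultimately have "\<alpha> j < \<alpha> k" "\<alpha>' j < \<alpha>' k"
        unfolding \<alpha>_def \<alpha>'_def using L by (simp_all add: div_add_self2)
      then show ?thesis by simp
    next
      case 3
      \<comment> \<open>The offsets \<open>w k - w j\<close> and one less pin down the gap exactly.
        Hence both cut points move by the same multiple of \<open>L * p\<close>, and both quotients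
        by the same multiple of \<open>p\<close>.\<close>
      have "w' k \<le> w' j + (w k - w j)"
        using diff[of k j "w k - w j"] jk 3 by simp
      moreover have "\<not> w' k \<le> w' j + (w k - w j - 1)"
        using diff[of k j "w k - w j - 1"] jk 3 by simp
      ultimately have eq: "w' k - w' j = w k - w j" by linarith
      obtain m n where "w' j = w j + L * int p * m" "\<alpha>' j = \<alpha> j + int p * m"
        "w' k = w k + L * int p * n" "\<alpha>' k = \<alpha> k + int p * n"
        using shift jk by meson
      moreover from this eq have "L * int p * m = L * int p * n" by linarith
      ultimately show ?thesis using L p by simp
    qed
  qed
  have cong': "[\<alpha> j = \<alpha>' j] (mod int p)" if "j \<in> J" for j
    using shift[OF that] by (auto simp: cong_iff_lin)
  have le: "L * k + r \<le> w j \<longleftrightarrow> k \<le> \<alpha> j" "L * k + r \<le> w' j \<longleftrightarrow> k \<le> \<alpha>' j" for j k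
    unfolding \<alpha>_def \<alpha>'_def le_div_iff_mult_le[OF L] by linarith+
  have inj: "inj (\<lambda>k. L * k + r)" using L by (auto intro: injI)
  show ?thesis
    unfolding residue_class_eq_image[OF r] le
    by (intro same_size_inj_image inj same_size_cut_cell fin ord cong')
qed

text \<open>The sets split into finitely many cells, each given by a position \<open>K\<close> among
  the cut points and a residue \<open>r\<close>. By \<open>type\<close> a cell lies inside or
  outside \<open>S\<close> as a whole, and the matching cell does the same with
  \<open>S'\<close>.\<close>

lemma same_size_cuts:
  fixes w w' :: "'j \<Rightarrow> int" and L :: int
  assumes fin: "finite J" and L: "L > 0" and p: "p > 0"
    and diff: "\<And>j k e. j \<in> J \<Longrightarrow> k \<in> J \<Longrightarrow> 0 \<le> e \<Longrightarrow> e \<le> L \<Longrightarrow>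
      w j \<le> w k + e \<longleftrightarrow> w' j \<le> w' k + e"
    and cong: "\<And>j. j \<in> J \<Longrightarrow> [w j = w' j] (mod L * int p)"
    and type: "\<And>x x'. {j \<in> J. x \<le> w j} = {j \<in> J. x' \<le> w' j} \<Longrightarrow> x mod L = x' mod L \<Longrightarrow>
      x \<in> S \<longleftrightarrow> x' \<in> S'"
  shows "same_size p S S'"
proof -
  define cell where "cell u = (\<lambda>(K, r). {x. {j \<in> J. x \<le> u j} = K \<and> x mod L = r})"
    for u :: "'j \<Rightarrow> int"
  define I where "I = Pow J \<times> {0..<L}"
  have "same_size p (\<Union>i\<in>I. S \<inter> cell w i) (\<Union>i\<in>I. S' \<inter> cell w' i)"
  proof (rule same_size_UN)
    show "finite I" using fin by (simp add: I_def)
    show "disjoint_family_on (\<lambda>i. S \<inter> cell w i) I" "disjoint_family_on (\<lambda>i. S' \<inter> cell w' i) I"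
      by (auto simp: disjoint_family_on_def cell_def)
    fix i assume "i \<in> I"
    then have sz: "same_size p (cell w i) (cell w' i)"
      using same_size_residue_cut_cell[OF fin _ _ p diff cong]
      by (auto simp: I_def cell_def)
    have tp: "x \<in> S \<longleftrightarrow> x' \<in> S'" if "x \<in> cell w i" "x' \<in> cell w' i" for x x'
      using that type[of x x'] by (auto simp: cell_def split: prod.splits)
    \<comment> \<open>Matching cells are nonempty together, so one point from each lets
      \<open>tp\<close> transfer membership across all points of both cells.\<close>
    consider "cell w i = {}" "cell w' i = {}" | a a' where "a \<in> cell w i" "a' \<in> cell w' i"
      using sz by (auto simp: same_size_def)
    then show "same_size p (S \<inter> cell w i) (S' \<inter> cell w' i)"
    proof cases
      case 1
      then show ?thesis by (simp add: same_size_def)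
    next
      case 2
      have "S \<inter> cell w i = (if a \<in> S then cell w i else {})"
        "S' \<inter> cell w' i = (if a \<in> S then cell w' i else {})"
        using tp 2 by auto
      then show ?thesis using sz by (simp add: same_size_def)
    qed
  qed
  moreover have "(\<Union>i\<in>I. T \<inter> cell u i) = T" for T u
    using L by (auto simp: I_def cell_def)
  ultimately show ?thesis by simp
qed

section \<open>Indistinguishable assignments\<close>

definition lin :: "nat set \<Rightarrow> (nat \<Rightarrow> int) \<Rightarrow> (nat \<Rightarrow> int) \<Rightarrow> int" where
  "lin V a v = (\<Sum>i\<in>V. a i * v i)"

text \<open>Only variables in \<open>V\<close> are inspected, so for finite \<open>V\<close>
  finitely many atoms describe the relation. Congruences of single variables suffice because they
  carry over to all terms.\<close>

definition indist :: "nat set \<Rightarrow> nat \<Rightarrow> int \<Rightarrow> (nat \<Rightarrow> int) \<Rightarrow> (nat \<Rightarrow> int) \<Rightarrow> bool" where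
  "indist V P C v v' \<longleftrightarrow>
     (\<forall>a c. (\<forall>i\<in>V. \<bar>a i\<bar> \<le> int P) \<and> \<bar>c\<bar> \<le> C \<longrightarrow> (lin V a v + c < 0 \<longleftrightarrow> lin V a v' + c < 0)) \<and>
     (\<forall>i\<in>V. \<forall>k\<in>{1..P}. [v i = v' i] (mod int k))"

lemma indist_Less:
  assumes "indist V P C v v'" "\<And>i. i \<in> V \<Longrightarrow> \<bar>a i\<bar> \<le> int P" "\<bar>c\<bar> \<le> C"
  shows "lin V a v + c < 0 \<longleftrightarrow> lin V a v' + c < 0"
  using assms unfolding indist_def by blast

lemma indist_cong:
  assumes "indist V P C v v'" "i \<in> V" "0 < k" "k \<le> P"
  shows "[v i = v' i] (mod int k)"
  using assms unfolding indist_def by simp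

lemma indist_mono:
  assumes "indist V P' C' v v'" "P \<le> P'" "C \<le> C'"
  shows "indist V P C v v'"
  unfolding indist_def
proof (intro conjI allI impI ballI; (elim conjE)?)
  fix a c assume "\<forall>i\<in>V. \<bar>a i\<bar> \<le> int P" "\<bar>c\<bar> \<le> C"
  with assms(2,3) show "lin V a v + c < 0 \<longleftrightarrow> lin V a v' + c < 0"
    by (intro indist_Less[OF assms(1)]) force+
next
  fix i k assume "i \<in> V" "k \<in> {1..P}"
  with assms(2) show "[v i = v' i] (mod int k)"
    by (intro indist_cong[OF assms(1)]) auto
qed

lemma lin_cong: "(\<And>i. i \<in> V \<Longrightarrow> [v i = v' i] (mod m)) \<Longrightarrow> [lin V a v = lin V a v'] (mod m)"
  unfolding lin_def by (intro cong_sum cong_scalar_left)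

text \<open>Multiply by \<open>b * c\<close> and replace \<open>b * (s div b)\<close> by
  \<open>s - s mod b\<close>. A comparison of rounded cut points becomes a linear inequality whose
  constant depends only on \<open>b\<close>, \<open>c\<close>, \<open>e\<close> and the
  remainders.\<close>

lemma div_le_div_iff:
  fixes s t b c e :: int
  assumes "b > 0" "c > 0"
  shows "s div b \<le> t div c + e \<longleftrightarrow>
    c * s - b * t + (b * (t mod c) - c * (s mod b) - e * (b * c)) - 1 < 0"
proof -
  have "s div b \<le> t div c + e \<longleftrightarrow> b * c * (s div b) \<le> b * c * (t div c + e)"
    using assms by simp
  also have "b * c * (s div b) = c * (s - s mod b)"
    by (simp add: minus_mod_eq_mult_div)
  also have "b * c * (t div c + e) = b * (t - t mod c) + e * (b * c)"
    by (simp add: minus_mod_eq_mult_div algebra_simps)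
  also have "c * (s - s mod b) \<le> b * (t - t mod c) + e * (b * c) \<longleftrightarrow>
      c * s - b * t + (b * (t mod c) - c * (s mod b) - e * (b * c)) - 1 < 0"
    unfolding right_diff_distrib by linarith
  finally show ?thesis .
qed

text \<open>The instance \<open>k = 1\<close> lets one divide \<open>n\<close> by \<open>m\<close>;
  every \<open>k\<close> up to \<open>P\<close> then divides the quotient.\<close>

lemma mult_Lcm_dvd:
  fixes n :: int
  assumes "\<And>k. 0 < k \<Longrightarrow> k \<le> P \<Longrightarrow> int (m * k) dvd n" "m > 0" "P > 0"
  shows "int (m * Lcm {1..P}) dvd n"
proof -
  from assms(1)[of 1] assms(3) obtain q where q: "n = int m * q" by auto
  have "k dvd nat \<bar>q\<bar>" if "k \<in> {1..P}" for k
    using assms(1)[of k] assms(2) that by (auto simp: q)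
  then have "Lcm {1..P} dvd nat \<bar>q\<bar>" by (rule Lcm_least)
  then show ?thesis by (auto simp: q)
qed


section \<open>Cut points for the quantified variable\<close>

definition cut :: "nat set \<Rightarrow> (nat \<Rightarrow> int) \<Rightarrow> (nat \<Rightarrow> int) \<times> int \<times> int \<Rightarrow> int" where
  "cut V v = (\<lambda>(a, c, b). (lin V a v + c) div b)"

text \<open>Coefficients vanish off \<open>V - {y}\<close>, which makes the set finite for finite
  \<open>V\<close> and the cut points independent of \<open>y\<close>. The constants reach
  \<open>C + 1\<close> to make room for turning strict bounds into non-strict ones.\<close>

definition cut_indices :: "nat set \<Rightarrow> nat \<Rightarrow> nat \<Rightarrow> int \<Rightarrow> ((nat \<Rightarrow> int) \<times> int \<times> int) set" where
  "cut_indices V y P C =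
     {a. \<forall>i. (i \<in> V - {y} \<longrightarrow> a i \<in> {- int P..int P}) \<and> (i \<notin> V - {y} \<longrightarrow> a i = 0)}
       \<times> {- C - 1..C + 1} \<times> {1..int P}"

lemma finite_cut_indices:
  assumes "finite V"
  shows "finite (cut_indices V y P C)"
proof -
  have "finite {a. \<forall>i. (i \<in> V - {y} \<longrightarrow> a i \<in> {- int P..int P}) \<and> (i \<notin> V - {y} \<longrightarrow> a i = 0)}"
    using assms by (intro finite_set_of_finite_funs) auto
  then show ?thesis unfolding cut_indices_def by blast
qed

lemma lin_upd:
  assumes "finite V" "y \<in> V"
  shows "lin V a (v(y := x)) = a y * x + lin V (\<lambda>i. if i \<in> V - {y} then a i else 0) v"
proof -
  have "lin V a (v(y := x)) = a y * x + (\<Sum>i\<in>V - {y}. a i * (v(y := x)) i)"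
    unfolding lin_def using assms by (subst sum.remove[of V y]) auto
  also have "(\<Sum>i\<in>V - {y}. a i * (v(y := x)) i) = (\<Sum>i\<in>V - {y}. a i * v i)"
    by (intro sum.cong) auto
  also have "(\<Sum>i\<in>V - {y}. a i * v i) = lin V (\<lambda>i. if i \<in> V - {y} then a i else 0) v"
    unfolding lin_def using assms by (subst sum.remove[of V y]) (auto intro: sum.cong)
  finally show ?thesis .
qed

text \<open>An inequality with a nonzero coefficient of \<open>y\<close> compares \<open>y\<close>
  with a single cut point, and \<open>cuts\<close> says that \<open>x\<close> and \<open>x'\<close>
  lie on the same side of it. Inequalities without \<open>y\<close> are covered by
  \<open>ind\<close>, and congruences of \<open>y\<close> by \<open>mods\<close>.\<close>

lemma indist_upd:
  assumes V: "finite V" "y \<in> V"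
    and ind: "indist V P C v v'"
    and cuts: "{j \<in> cut_indices V y P C. x \<le> cut V v j} =
      {j \<in> cut_indices V y P C. x' \<le> cut V v' j}"
    and mods: "x mod int (Lcm {1..P}) = x' mod int (Lcm {1..P})"
  shows "indist V P C (v(y := x)) (v'(y := x'))"
  unfolding indist_def
proof (intro conjI allI impI ballI; (elim conjE)?)
  fix a c assume a: "\<forall>i\<in>V. \<bar>a i\<bar> \<le> int P" and c: "\<bar>c\<bar> \<le> C"
  define b where "b = (\<lambda>i. if i \<in> V - {y} then a i else 0)"
  have upd: "lin V a (u(y := z)) = a y * z + lin V b u" for u z
    unfolding b_def by (rule lin_upd[OF V])
  have cut_iff: "x \<le> cut V v j \<longleftrightarrow> x' \<le> cut V v' j" if "j \<in> cut_indices V y P C" for j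
    using cuts that by blast
  have ay: "\<bar>a y\<bar> \<le> int P" using a V by blast
  consider "a y = 0" | "a y < 0" | "a y > 0" by linarith
  then show "lin V a (v(y := x)) + c < 0 \<longleftrightarrow> lin V a (v'(y := x')) + c < 0"
  proof cases
    case 1
    have "lin V b v + c < 0 \<longleftrightarrow> lin V b v' + c < 0"
      using a c by (intro indist_Less[OF ind]) (auto simp: b_def)
    with 1 show ?thesis by (simp add: upd)
  next
    case 2
    have "(b, c, - a y) \<in> cut_indices V y P C"
      using a c ay 2 by (auto simp: cut_indices_def b_def abs_le_iff)
    from cut_iff[OF this] have "- a y * x \<le> lin V b v + c \<longleftrightarrow> - a y * x' \<le> lin V b v' + c"
      using 2 by (simp add: cut_def le_div_iff_mult_le)
    then show ?thesis by (auto simp: upd)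
  next
    case 3
    \<comment> \<open>A positive coefficient gives the strict bound
      \<open>a y * x < - lin V b v - c\<close>; over the integers the non-strict form has constant
      \<open>- c - 1\<close>.\<close>
    have "(\<lambda>i. - b i, - c - 1, a y) \<in> cut_indices V y P C"
      using a c ay 3 by (auto simp: cut_indices_def b_def abs_le_iff)
    moreover have "lin V (\<lambda>i. - b i) u = - lin V b u" for u
      by (simp add: lin_def sum_negf)
    ultimately have "a y * x \<le> - lin V b v + (- c - 1) \<longleftrightarrow> a y * x' \<le> - lin V b v' + (- c - 1)"
      using 3 cut_iff[of "(\<lambda>i. - b i, - c - 1, a y)"] by (simp add: cut_def le_div_iff_mult_le)
    then show ?thesis by (auto simp: upd)
  qed
next
  fix i k assume i: "i \<in> V" and k: "k \<in> {1..P}"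
  have "int k dvd int (Lcm {1..P})" using k by (simp add: dvd_Lcm)
  with mods have "[x = x'] (mod int k)"
    by (metis cong_def mod_mod_cancel)
  moreover have "[v i = v' i] (mod int k)" using k i by (intro indist_cong[OF ind]) auto
  ultimately show "[(v(y := x)) i = (v'(y := x')) i] (mod int k)" by simp
qed

text \<open>A congruence modulo \<open>b * p * Lcm {1..P}\<close> follows from congruences modulo the numbers
  \<open>b * p * k\<close> with \<open>k \<le> P\<close>: this keeps the moduli polynomial in \<open>P\<close>.\<close>

lemma same_size_indist:
  assumes V: "finite V" "y \<in> V"
    and P: "P \<ge> 2" and C: "C \<ge> 0" and p: "0 < p" "p \<le> P"
    and ind: "indist V (P ^ 4) C' v v'"
    and C': "2 * int P * (C + 1) + int P ^ 2 * (1 + int (Lcm {1..P})) + 1 \<le> C'"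
    and X: "\<And>u u'. indist V P C u u' \<Longrightarrow> X u \<longleftrightarrow> X u'"
  shows "same_size p {x. X (v(y := x))} {x. X (v'(y := x))}"
proof -
  define L where "L = int (Lcm {1..P})"
  have "Lcm {1..P} \<noteq> 0" by (simp add: Lcm_0_iff)
  then have L: "L > 0" unfolding L_def by (simp only: of_nat_0_less_iff neq0_conv)
  \<comment> \<open>The number \<open>2 * P ^ 2\<close> will bound the coefficients obtained by
    cross-multiplying two cut points.\<close>
  have P24: "2 * (int P * int P) \<le> int (P ^ 4)"
  proof -
    have "2 * 1 \<le> int P * int P" using P by (intro mult_mono) auto
    then have "2 * (int P * int P) \<le> (int P * int P) * (int P * int P)"
      by (intro mult_right_mono) auto
    then show ?thesis by (simp add: power4_eq_xxxx mult.assoc)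
  qed
  have var_cong: "[v i = v' i] (mod int (b * p * Lcm {1..P}))"
    if "i \<in> V" "0 < b" "b \<le> P" for i b
  proof -
    have "int (b * p * k) dvd v i - v' i" if k: "0 < k" "k \<le> P" for k
    proof -
      have "b * p * k \<le> P * P * P"
        using p k \<open>b \<le> P\<close> by (intro mult_mono) auto
      also have "\<dots> \<le> P * P * P * P" using P by simp
      also have "\<dots> = P ^ 4" by (simp add: power4_eq_xxxx)
      finally show ?thesis
        using indist_cong[OF ind, of i "b * p * k"] that p \<open>0 < b\<close> k \<open>i \<in> V\<close>
        by (simp add: cong_iff_dvd_diff)
    qed
    then have "int (b * p * Lcm {1..P}) dvd v i - v' i"
      using p \<open>0 < b\<close> P by (intro mult_Lcm_dvd) auto
    then show ?thesis by (simp add: cong_iff_dvd_diff)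
  qed
  \<comment> \<open>The factor \<open>b\<close> in the modulus is lost when dividing by
    \<open>b\<close>, which leaves the cut points congruent modulo \<open>L * p\<close>.\<close>
  have lin_cong': "[lin V a v + c = lin V a v' + c] (mod b * (L * int p))"
    if "0 < b" "b \<le> int P" for a b c
  proof -
    have "[lin V a v = lin V a v'] (mod int (nat b * p * Lcm {1..P}))"
      using that by (intro lin_cong var_cong) auto
    moreover have "int (nat b * p * Lcm {1..P}) = b * (L * int p)"
      using that by (simp add: L_def mult_ac)
    ultimately show ?thesis by (simp only: cong_add_rcancel)
  qed
  define J where "J = cut_indices V y P C"
  show ?thesis
  proof (rule same_size_cuts[of J L p "cut V v" "cut V v'"])
    show "finite J" unfolding J_def using V by (intro finite_cut_indices)
    show "[cut V v j = cut V v' j] (mod L * int p)" if "j \<in> J" for j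
    proof -
      obtain a c b where j: "j = (a, c, b)" by (cases j)
      with that have b: "0 < b" "b \<le> int P" by (auto simp: J_def cut_indices_def)
      from lin_cong'[OF this, of a c] obtain m where
        "lin V a v' + c = lin V a v + c + b * (L * int p * m)"
        by (auto simp: cong_iff_lin mult_ac)
      then have "cut V v' j = (lin V a v + c + b * (L * int p * m)) div b"
        by (simp only: cut_def j prod.case)
      also have "\<dots> = L * int p * m + cut V v j"
        using b div_mult_self2[of b "lin V a v + c" "L * int p * m"]
        by (simp only: cut_def j prod.case less_irrefl)
      finally have "cut V v' j = cut V v j + L * int p * m" by simp
      then show ?thesis by (simp add: cong_iff_lin)
    qed
    show "cut V v j \<le> cut V v k + e \<longleftrightarrow> cut V v' j \<le> cut V v' k + e"
      if jk: "j \<in> J" "k \<in> J" and e: "0 \<le> e" "e \<le> L" for j k e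
    proof -
      obtain a c b a' c' b' where jk_eq: "j = (a, c, b)" "k = (a', c', b')"
        by (cases j, cases k)
      with jk have b: "0 < b" "b \<le> int P" and b': "0 < b'" "b' \<le> int P"
        and c: "\<bar>c\<bar> \<le> C + 1" "\<bar>c'\<bar> \<le> C + 1"
        and a: "\<And>i. i \<in> V \<Longrightarrow> \<bar>a i\<bar> \<le> int P" "\<And>i. i \<in> V \<Longrightarrow> \<bar>a' i\<bar> \<le> int P"
        by (fastforce simp: J_def cut_indices_def abs_le_iff)+
      define r where "r = (lin V a v + c) mod b"
      define r' where "r' = (lin V a' v + c') mod b'"
      have "[lin V a v + c = lin V a v' + c] (mod b)"
        "[lin V a' v + c' = lin V a' v' + c'] (mod b')"
        using lin_cong'[OF b] lin_cong'[OF b'] cong_modulus_mult by blast+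
      then have r: "(lin V a v' + c) mod b = r" "(lin V a' v' + c') mod b' = r'"
        by (simp_all add: r_def r'_def cong_def)
      \<comment> \<open>These are the coefficients and the constant produced by
        \<open>div_le_div_iff\<close>. The remainders \<open>r\<close> and \<open>r'\<close> are
        shared by \<open>v\<close> and \<open>v'\<close>, so one \<open>g\<close> serves both
        assignments.\<close>
      define f where "f i = b' * a i - b * a' i" for i
      define g where "g = b' * c - b * c' + (b * r' - b' * r - e * (b * b')) - 1"
      have f: "lin V f u = b' * lin V a u - b * lin V a' u" for u
        unfolding lin_def f_def by (simp add: sum_distrib_left sum_subtractf algebra_simps)
      have "lin V f v + g < 0 \<longleftrightarrow> lin V f v' + g < 0"
      proof (rule indist_Less[OF ind])
        fix i assume i: "i \<in> V"
        have "\<bar>f i\<bar> \<le> \<bar>b'\<bar> * \<bar>a i\<bar> + \<bar>b\<bar> * \<bar>a' i\<bar>"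
          unfolding f_def abs_mult[symmetric] by (rule abs_triangle_ineq4)
        also have "\<dots> \<le> int P * int P + int P * int P"
          using a[OF i] b b' by (intro add_mono mult_mono) auto
        also have "\<dots> \<le> int (P ^ 4)" using P24 by linarith
        finally show "\<bar>f i\<bar> \<le> int (P ^ 4)" .
      next
        have rb: "0 \<le> r" "r \<le> int P" "0 \<le> r'" "r' \<le> int P"
          using b b' by (auto simp: r_def r'_def intro: order.trans[OF less_imp_le[OF pos_mod_bound]])
        have 1: "\<bar>b' * c\<bar> \<le> int P * (C + 1)" "\<bar>b * c'\<bar> \<le> int P * (C + 1)"
          unfolding abs_mult using b b' c by (auto intro!: mult_mono)
        have 2: "0 \<le> b * r'" "b * r' \<le> int P * int P" "0 \<le> b' * r" "b' * r \<le> int P * int P"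
          using b b' rb by (auto intro!: mult_mono)
        have 3: "0 \<le> e * (b * b')" "e * (b * b') \<le> L * (int P * int P)"
          using b b' e L by (auto intro!: mult_mono)
        \<comment> \<open>The summands bound, in order, the two constants, the difference of the
          remainder terms, the offset \<open>e\<close>, and the 1 from strictness.\<close>
        have "2 * (int P * (C + 1)) + int P * int P + L * (int P * int P) + 1 \<le> C'"
          using C' by (simp add: L_def algebra_simps power2_eq_square)
        with 1 2 3 show "\<bar>g\<bar> \<le> C'" unfolding g_def by linarith
      qed
      then show ?thesis
        using b b' unfolding jk_eq cut_def
        by (simp add: div_le_div_iff r f g_def flip: r_def r'_def) (simp add: algebra_simps)
    qed
  next
    fix x x' assume t: "{j \<in> J. x \<le> cut V v j} = {j \<in> J. x' \<le> cut V v' j}" "x mod L = x' mod L"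
    have "P \<le> P ^ 4" using P by (intro self_le_power) auto
    moreover have "C \<le> C'"
    proof -
      have "C \<le> 1 * (C + 1)" by simp
      also have "\<dots> \<le> 2 * int P * (C + 1)" using P C by (intro mult_right_mono) auto
      also have "\<dots> \<le> 2 * int P * (C + 1) + (int P ^ 2 * (1 + int (Lcm {1..P})) + 1)"
        by (intro le_add_same_cancel1[THEN iffD2]) simp
      also have "\<dots> \<le> C'" using C' by (simp only: add.assoc)
      finally show ?thesis .
    qed
    ultimately have "indist V P C v v'" by (rule indist_mono[OF ind])
    with V t show "x \<in> {x. X (v(y := x))} \<longleftrightarrow> x' \<in> {x. X (v'(y := x))}"
      unfolding mem_Collect_eq J_def L_def by (intro X indist_upd)
  qed (use L p in auto)
qed


section \<open>Formulas within given parameter bounds\<close>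

lemma eval_less_iff_lin:
  assumes "finite V" "vars s \<union> vars t \<subseteq> V"
  shows "eval v s < eval v t \<longleftrightarrow> lin V (var_coeff (Sub s t)) v + nf_const (Sub s t) < 0"
proof -
  have "vars (Sub s t) \<subseteq> V" using assms(2) by (simp add: Sub_def)
  from eval_eq_sum[OF assms(1) this, of v]
  have "eval v (Sub s t) = lin V (var_coeff (Sub s t)) v + nf_const (Sub s t)"
    by (simp add: lin_def)
  moreover have "eval v (Sub s t) = eval v s - eval v t" by (simp add: Sub_def)
  ultimately show ?thesis by linarith
qed

lemma eval_cong:
  assumes "\<And>i. i \<in> vars t \<Longrightarrow> [v i = v' i] (mod m)"
  shows "[eval v t = eval v' t] (mod m)"
  using assms
proof (induction t)
  case (Add s t)
  then show ?case by (simp add: cong_add)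
next
  case (Mul a t)
  then show ?case by (simp add: cong_scalar_left)
qed simp_all

text \<open>Bound variables are included so that one fixed \<open>V\<close> serves every subformula
  in the induction.\<close>

primrec fm_vars :: "fm \<Rightarrow> nat set" where
  "fm_vars (Less s t) = vars s \<union> vars t"
| "fm_vars (Congr k s t) = vars s \<union> vars t"
| "fm_vars (Neg \<phi>) = fm_vars \<phi>"
| "fm_vars (And \<phi> \<psi>) = fm_vars \<phi> \<union> fm_vars \<psi>"
| "fm_vars (Or \<phi> \<psi>) = fm_vars \<phi> \<union> fm_vars \<psi>"
| "fm_vars (Imp \<phi> \<psi>) = fm_vars \<phi> \<union> fm_vars \<psi>"
| "fm_vars (Iff \<phi> \<psi>) = fm_vars \<phi> \<union> fm_vars \<psi>"
| "fm_vars (Ex y \<phi>) = insert y (fm_vars \<phi>)"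
| "fm_vars (ExMod q p y \<phi>) = insert y (fm_vars \<phi>)"

lemma finite_fm_vars: "finite (fm_vars \<phi>)"
  by (induction \<phi>) (auto simp: finite_vars)

text \<open>A recursive form of the parameter bounds, suited to induction;
  \<open>fits_iff_Max\<close> links it to the maxima.\<close>

primrec fits :: "nat \<Rightarrow> int \<Rightarrow> fm \<Rightarrow> bool" where
  "fits P C (Less s t) \<longleftrightarrow> (\<forall>i. \<bar>var_coeff (Sub s t) i\<bar> \<le> int P) \<and> \<bar>nf_const (Sub s t)\<bar> \<le> C"
| "fits P C (Congr k s t) \<longleftrightarrow> k \<le> P"
| "fits P C (Neg \<phi>) \<longleftrightarrow> fits P C \<phi>"
| "fits P C (And \<phi> \<psi>) \<longleftrightarrow> fits P C \<phi> \<and> fits P C \<psi>"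
| "fits P C (Or \<phi> \<psi>) \<longleftrightarrow> fits P C \<phi> \<and> fits P C \<psi>"
| "fits P C (Imp \<phi> \<psi>) \<longleftrightarrow> fits P C \<phi> \<and> fits P C \<psi>"
| "fits P C (Iff \<phi> \<psi>) \<longleftrightarrow> fits P C \<phi> \<and> fits P C \<psi>"
| "fits P C (Ex y \<phi>) \<longleftrightarrow> fits P C \<phi>"
| "fits P C (ExMod q p y \<phi>) \<longleftrightarrow> p \<le> P \<and> fits P C \<phi>"

lemma fits_iff_subformulas:
  "fits P C \<phi> \<longleftrightarrow>
     (\<forall>s t. Less s t \<in> subformulas \<phi> \<longrightarrow>
        (\<forall>i. \<bar>var_coeff (Sub s t) i\<bar> \<le> int P) \<and> \<bar>nf_const (Sub s t)\<bar> \<le> C) \<and>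
     (\<forall>k s t. Congr k s t \<in> subformulas \<phi> \<longrightarrow> k \<le> P) \<and>
     (\<forall>q k y \<psi>. ExMod q k y \<psi> \<in> subformulas \<phi> \<longrightarrow> k \<le> P)"
proof -
  have "fits P C \<phi> \<longleftrightarrow> (\<forall>\<psi>\<in>subformulas \<phi>. case \<psi> of
      Less s t \<Rightarrow> (\<forall>i. \<bar>var_coeff (Sub s t) i\<bar> \<le> int P) \<and> \<bar>nf_const (Sub s t)\<bar> \<le> C
    | Congr k s t \<Rightarrow> k \<le> P | ExMod q k y \<chi> \<Rightarrow> k \<le> P | _ \<Rightarrow> True)" (is "_ \<longleftrightarrow> (\<forall>\<psi>\<in>_. ?R \<psi>)")
    by (induction \<phi>) (simp_all add: ball_Un)
  also have "\<dots> \<longleftrightarrow>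
     (\<forall>s t. Less s t \<in> subformulas \<phi> \<longrightarrow>
        (\<forall>i. \<bar>var_coeff (Sub s t) i\<bar> \<le> int P) \<and> \<bar>nf_const (Sub s t)\<bar> \<le> C) \<and>
     (\<forall>k s t. Congr k s t \<in> subformulas \<phi> \<longrightarrow> k \<le> P) \<and>
     (\<forall>q k y \<psi>. ExMod q k y \<psi> \<in> subformulas \<phi> \<longrightarrow> k \<le> P)"
    (is "_ \<longleftrightarrow> ?S")
  proof
    assume R: "\<forall>\<psi>\<in>subformulas \<phi>. ?R \<psi>"
    show ?S by (intro conjI allI impI; drule R[rule_format]; simp)
  next
    assume ?S
    then show "\<forall>\<psi>\<in>subformulas \<phi>. ?R \<psi>"
      by (intro ballI) (simp split: fm.split, blast)
  qed
  finally show ?thesis .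
qed

text \<open>Closure of \<open>Coeff\<close> and \<open>Const\<close> under negation turns upper
  bounds into bounds on absolute values. The lower bounds 2 absorb the elements that these sets and
  \<open>Mod\<close> always contain.\<close>

lemma fits_iff_Max:
  assumes "P \<ge> 2" "C \<ge> 2"
  shows "fits P C \<phi> \<longleftrightarrow> Max (Params \<phi>) \<le> int P \<and> Max (Const \<phi>) \<le> C"
proof -
  have nf: "(\<forall>x\<in>nf_coeffs t \<union> uminus ` nf_coeffs t. x \<le> int P) \<longleftrightarrow>
      (\<forall>i. \<bar>var_coeff t i\<bar> \<le> int P)" for t
  proof -
    have "(\<forall>x\<in>nf_coeffs t \<union> uminus ` nf_coeffs t. x \<le> int P) \<longleftrightarrow>
        (\<forall>i. var_coeff t i \<noteq> 0 \<longrightarrow> var_coeff t i \<le> int P \<and> - var_coeff t i \<le> int P)"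
      by (auto simp: nf_coeffs_def nf_vars_def)
    also have "\<dots> \<longleftrightarrow> (\<forall>i. \<bar>var_coeff t i\<bar> \<le> int P)"
      by (intro iff_allI) (auto simp: abs_le_iff)
    finally show ?thesis .
  qed
  have ball_Union: "(\<forall>x\<in>\<Union>{A s t | s t. B s t}. R x) \<longleftrightarrow> (\<forall>s t. B s t \<longrightarrow> (\<forall>x\<in>A s t. R x))"
    for A and B :: "tm \<Rightarrow> tm \<Rightarrow> bool" and R :: "int \<Rightarrow> bool" by blast
  have Coeff: "(\<forall>x\<in>Coeff \<phi>. x \<le> int P) \<longleftrightarrow>
      (\<forall>s t. Less s t \<in> subformulas \<phi> \<longrightarrow> (\<forall>i. \<bar>var_coeff (Sub s t) i\<bar> \<le> int P))"
    unfolding Coeff_def ball_Un[of "{_, _, _, _, _}"] ball_Union nf using assms by simp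
  have Mod: "(\<forall>x\<in>int ` Mod \<phi>. x \<le> int P) \<longleftrightarrow>
      (\<forall>k s t. Congr k s t \<in> subformulas \<phi> \<longrightarrow> k \<le> P) \<and>
      (\<forall>q k y \<psi>. ExMod q k y \<psi> \<in> subformulas \<phi> \<longrightarrow> k \<le> P)"
  proof -
    have "(\<forall>x\<in>int ` Mod \<phi>. x \<le> int P) \<longleftrightarrow> (\<forall>k\<in>Mod \<phi>. k \<le> P)" by simp
    also have "\<dots> \<longleftrightarrow> (\<forall>k. (\<exists>s t. Congr k s t \<in> subformulas \<phi>) \<longrightarrow> k \<le> P) \<and>
        (\<forall>k. (\<exists>q y \<psi>. ExMod q k y \<psi> \<in> subformulas \<phi>) \<longrightarrow> k \<le> P)"
      unfolding Mod_def ball_Un using assms by simp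
    finally show ?thesis by blast
  qed
  have Const: "(\<forall>x\<in>Const \<phi>. x \<le> C) \<longleftrightarrow>
      (\<forall>s t. Less s t \<in> subformulas \<phi> \<longrightarrow> \<bar>nf_const (Sub s t)\<bar> \<le> C)"
    unfolding Const_def ball_Un ball_Union abs_le_iff using assms by simp
  have ne: "Params \<phi> \<noteq> {}" "Const \<phi> \<noteq> {}" by (simp_all add: Params_def Coeff_def Const_def)
  have "Max (Params \<phi>) \<le> int P \<and> Max (Const \<phi>) \<le> C \<longleftrightarrow>
      ((\<forall>x\<in>Coeff \<phi>. x \<le> int P) \<and> (\<forall>x\<in>int ` Mod \<phi>. x \<le> int P)) \<and> (\<forall>x\<in>Const \<phi>. x \<le> C)"
    unfolding Max_le_iff[OF finite_Params ne(1)] Max_le_iff[OF finite_Const ne(2)]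
    by (simp only: Params_def ball_Un)
  then show ?thesis
    unfolding Coeff Mod Const fits_iff_subformulas by blast
qed

section \<open>Growth of the constants\<close>

lemma Lcm_le_two_power: "Lcm {1..n} \<le> (2::nat) ^ (n * n)"
proof -
  have "Lcm {1..n} dvd (fact n :: nat)" by (intro Lcm_least dvd_fact) auto
  then have "Lcm {1..n} \<le> (fact n :: nat)" by (rule dvd_imp_le) simp
  also have "\<dots> \<le> n ^ n" using fact_le_power[of n, where 'a=nat] by simp
  also have "\<dots> \<le> (2 ^ n) ^ n" by (intro power_mono) (auto intro: less_imp_le)
  finally show ?thesis by (simp add: power_mult)
qed

text \<open>One quantifier raises the level from \<open>Q\<close> to \<open>Q ^ 4\<close>. The left
  side is the requirement of \<open>same_size_indist\<close> with constant bound
  \<open>2 ^ Q * C\<close>; estimating every factor by a power of 2 leaves the exponent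
  \<open>Q * Q + 2 * Q + 3\<close>.\<close>

lemma elimination_const_bound:
  fixes Q :: nat and C :: int
  assumes "Q \<ge> 2" "C \<ge> 1"
  shows "2 * int Q * (2 ^ Q * C + 1) + int Q ^ 2 * (1 + int (Lcm {1..Q})) + 1 \<le> 2 ^ (Q ^ 4) * C"
proof -
  have Q: "int Q \<le> 2 ^ Q" by (metis less_exp less_imp_le of_nat_le_numeral_power_cancel_iff)
  have "1 \<le> (2::int) ^ Q * C"
    using mult_mono[of "1::int" "2 ^ Q" 1 C] one_le_power[of "2::int" Q] assms(2) by linarith
  then have "2 * int Q * (2 ^ Q * C + 1) \<le> 2 * 2 ^ Q * (2 ^ Q * C + 2 ^ Q * C)"
    using Q assms by (intro mult_mono) (auto simp: mult.commute)
  also have "\<dots> = 2 ^ (2 * Q + 2) * C"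
    by (simp add: power_add power_mult power2_eq_square algebra_simps)
  also have "\<dots> \<le> 2 ^ (Q * Q + 2 * Q + 2) * C"
    using assms by (intro mult_right_mono power_increasing) auto
  finally have 1: "2 * int Q * (2 ^ Q * C + 1) \<le> 2 ^ (Q * Q + 2 * Q + 2) * C" .
  have "int (Lcm {1..Q}) \<le> 2 ^ (Q * Q)" using Lcm_le_two_power[of Q]
    by (metis of_nat_le_numeral_power_cancel_iff)
  then have "1 + int (Lcm {1..Q}) \<le> 2 * 2 ^ (Q * Q)"
    using one_le_power[of "2::int" "Q * Q"] by linarith
  then have "int Q ^ 2 * (1 + int (Lcm {1..Q})) \<le> (2 ^ Q) ^ 2 * (2 * 2 ^ (Q * Q))"
    using Q by (intro mult_mono power_mono) auto
  also have "\<dots> = 2 ^ (Q * Q + 2 * Q + 1)"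
    by (simp add: power_add power_mult power2_eq_square algebra_simps)
  finally have "int Q ^ 2 * (1 + int (Lcm {1..Q})) + 1
      \<le> 2 ^ (Q * Q + 2 * Q + 1) + 2 ^ (Q * Q + 2 * Q + 1)"
    using one_le_power[of "2::int" "Q * Q + 2 * Q + 1"] by linarith
  also have "\<dots> = 2 ^ (Q * Q + 2 * Q + 2) * 1" by simp
  also have "\<dots> \<le> 2 ^ (Q * Q + 2 * Q + 2) * C" using assms by (intro mult_left_mono) auto
  finally have "2 * int Q * (2 ^ Q * C + 1) + int Q ^ 2 * (1 + int (Lcm {1..Q})) + 1
      \<le> 2 ^ (Q * Q + 2 * Q + 2) * C + 2 ^ (Q * Q + 2 * Q + 2) * C"
    using 1 by linarith
  also have "\<dots> = 2 ^ (Q * Q + 2 * Q + 3) * C" by (simp add: power_add)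
  also have "\<dots> \<le> 2 ^ (Q ^ 4) * C"
  proof (intro mult_right_mono power_increasing)
    have "4 \<le> Q * Q" "2 * Q \<le> Q * Q" using assms mult_le_mono[of 2 Q 2 Q] by auto
    moreover from this have "4 * (Q * Q) \<le> (Q * Q) * (Q * Q)" by (intro mult_right_mono) auto
    ultimately have "Q * Q + 2 * Q + 3 \<le> (Q * Q) * (Q * Q)" by linarith
    then show "Q * Q + 2 * Q + 3 \<le> Q ^ 4" by (simp add: power4_eq_xxxx mult.assoc)
  qed (use assms in auto)
  finally show ?thesis .
qed

lemma same_size_quantifier:
  assumes "finite V" "y \<in> V" "P \<ge> 2" "C \<ge> 2" "0 < p" "p \<le> P ^ 4 ^ d"
    and "indist V (P ^ 4 ^ Suc d) (2 ^ (P ^ 4 ^ Suc d) * C) v v'"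
    and "\<And>u u'. indist V (P ^ 4 ^ d) (2 ^ (P ^ 4 ^ d) * C) u u' \<Longrightarrow> X u \<longleftrightarrow> X u'"
  shows "same_size p {x. X (v(y := x))} {x. X (v'(y := x))}"
proof -
  have Q: "2 \<le> P ^ 4 ^ d" using assms(3) self_le_power[of P "4 ^ d"] by simp
  have "P ^ 4 ^ Suc d = (P ^ 4 ^ d) ^ 4" by (simp flip: power_mult add: mult.commute)
  with assms elimination_const_bound[OF Q, of C] show ?thesis
    by (intro same_size_indist[OF assms(1,2) Q _ assms(5,6) _ _ assms(8)]) auto
qed

text \<open>At a quantifier, the induction hypothesis makes the body invariant one level lower, so
  \<open>same_size_quantifier\<close> compares its two solution sets. The depth is only bounded by
  \<open>d\<close>, so both sides of a binary connective can use the same level.\<close>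

lemma indist_sat:
  assumes V: "finite V" and P: "P \<ge> 2" and C: "C \<ge> 2"
  shows "FO_mod \<phi> \<Longrightarrow> fits P C \<phi> \<Longrightarrow> fm_vars \<phi> \<subseteq> V \<Longrightarrow> qdepth \<phi> \<le> d \<Longrightarrow>
    indist V (P ^ 4 ^ d) (2 ^ (P ^ 4 ^ d) * C) v v' \<Longrightarrow> sat v \<phi> \<longleftrightarrow> sat v' \<phi>"
proof (induction \<phi> arbitrary: d v v')
  case (Less s t)
  have "P \<le> P ^ 4 ^ d" using P by (intro self_le_power) auto
  moreover have "1 * C \<le> 2 ^ (P ^ 4 ^ d) * C" using C by (intro mult_right_mono) auto
  ultimately have "indist V P C v v'" using Less.prems by (intro indist_mono[OF Less.prems(5)]) auto
  then have "lin V (var_coeff (Sub s t)) v + nf_const (Sub s t) < 0 \<longleftrightarrow>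
      lin V (var_coeff (Sub s t)) v' + nf_const (Sub s t) < 0"
    using Less.prems by (intro indist_Less) auto
  then show ?case using Less.prems V by (simp add: eval_less_iff_lin[of V])
next
  case (Congr k s t)
  have "P \<le> P ^ 4 ^ d" using P by (intro self_le_power) auto
  then have "[v i = v' i] (mod int k)" if "i \<in> V" for i
    using Congr.prems that by (intro indist_cong[OF Congr.prems(5)]) auto
  then have "[eval v s = eval v' s] (mod int k)" "[eval v t = eval v' t] (mod int k)"
    using Congr.prems by (auto intro!: eval_cong)
  then show ?case by (auto simp: cong_def)
next
  case (Ex y \<phi>)
  then obtain e where e: "d = Suc e" "qdepth \<phi> \<le> e" by (cases d) auto
  \<comment> \<open>Only emptiness matters here; modulus 1 makes the congruence trivial.\<close>
  have "same_size 1 {x. sat (v(y := x)) \<phi>} {x. sat (v'(y := x)) \<phi>}"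
  proof (rule same_size_quantifier[of V y P C _ e])
    show "indist V (P ^ 4 ^ Suc e) (2 ^ (P ^ 4 ^ Suc e) * C) v v'" using Ex.prems(5) e by simp
    show "sat u \<phi> \<longleftrightarrow> sat u' \<phi>" if "indist V (P ^ 4 ^ e) (2 ^ (P ^ 4 ^ e) * C) u u'" for u u'
      using Ex.prems that e(2) by (intro Ex.IH) auto
  qed (use Ex.prems V P C in auto)
  then show ?case by (auto simp: same_size_def)
next
  case (ExMod q p y \<phi>)
  then obtain e where e: "d = Suc e" "qdepth \<phi> \<le> e" by (cases d) auto
  have "same_size p {x. sat (v(y := x)) \<phi>} {x. sat (v'(y := x)) \<phi>}"
  proof (rule same_size_quantifier[of V y P C _ e])
    show "indist V (P ^ 4 ^ Suc e) (2 ^ (P ^ 4 ^ Suc e) * C) v v'" using ExMod.prems(5) e by simp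
    show "sat u \<phi> \<longleftrightarrow> sat u' \<phi>" if "indist V (P ^ 4 ^ e) (2 ^ (P ^ 4 ^ e) * C) u u'" for u u'
      using ExMod.prems that e(2) by (intro ExMod.IH) auto
    have "P \<le> P ^ 4 ^ e" using P by (intro self_le_power) auto
    then show "p \<le> P ^ 4 ^ e" using ExMod.prems by simp
  qed (use ExMod.prems V P C in auto)
  then show ?case by (auto simp: same_size_def cong_def)
next
  case (Neg \<phi>)
  then show ?case using Neg.IH[of d v v'] by simp
next
  case (And \<phi> \<psi>)
  then show ?case using And.IH(1)[of d v v'] And.IH(2)[of d v v'] by simp
next
  case (Or \<phi> \<psi>)
  then show ?case using Or.IH(1)[of d v v'] Or.IH(2)[of d v v'] by simp
next
  case (Imp \<phi> \<psi>)
  then show ?case using Imp.IH(1)[of d v v'] Imp.IH(2)[of d v v'] by simp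
next
  case (Iff \<phi> \<psi>)
  then show ?case using Iff.IH(1)[of d v v'] Iff.IH(2)[of d v v'] by simp
qed


section \<open>Boolean combinations of finitely many atoms\<close>

text \<open>Shannon expansion along \<open>F\<close>, for a semantic property \<open>X\<close>:
  split on the truth value of one atom and recurse. Without atoms \<open>X\<close> is
  constant.\<close>

lemma boolean_combination_of_atoms:
  assumes "finite F" "\<And>f. f \<in> F \<Longrightarrow> boolean_combination f \<and> fits P C f" "C \<ge> 0"
    and "\<And>v v'. (\<forall>f\<in>F. sat v f \<longleftrightarrow> sat v' f) \<Longrightarrow> X v \<longleftrightarrow> X v'"
  shows "\<exists>\<gamma>. boolean_combination \<gamma> \<and> fits P C \<gamma> \<and> (\<forall>v. sat v \<gamma> \<longleftrightarrow> X v)"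
  using assms(1,2,4)
proof (induction F arbitrary: X rule: finite_induct)
  case empty
  define bot_fm where "bot_fm = Less (Cst 0) (Cst 0)"
  have bot_fm: "boolean_combination bot_fm" "fits P C bot_fm" "\<not> sat v bot_fm" for v
    using assms(3) by (auto simp: bot_fm_def Sub_def)
  show ?case
  proof (cases "\<exists>v. X v")
    case True
    then obtain v\<^sub>0 where "X v\<^sub>0" by blast
    then have "X v" for v using empty.prems(2)[of v v\<^sub>0] by simp
    with bot_fm show ?thesis by (intro exI[of _ "Neg bot_fm"]) simp
  next
    case False
    with bot_fm show ?thesis by blast
  qed
next
  case (insert f F)
  \<comment> \<open>Quantifying over a witness \<open>v'\<close> makes \<open>X1 b\<close> depend on
    the atoms of \<open>F\<close> alone. It agrees with \<open>X\<close> wherever \<open>f\<close>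
    has truth value \<open>b\<close>.\<close>
  define X1 where "X1 b v \<longleftrightarrow> (\<exists>v'. sat v' f = b \<and> (\<forall>g\<in>F. sat v g \<longleftrightarrow> sat v' g) \<and> X v')" for b v
  have "\<exists>\<gamma>. boolean_combination \<gamma> \<and> fits P C \<gamma> \<and> (\<forall>v. sat v \<gamma> \<longleftrightarrow> X1 b v)" for b
    using insert.prems(1) by (intro insert.IH) (auto simp: X1_def)
  then obtain \<gamma> where \<gamma>: "\<And>b. boolean_combination (\<gamma> b)" "\<And>b. fits P C (\<gamma> b)"
    "\<And>b v. sat v (\<gamma> b) \<longleftrightarrow> X1 b v" by metis
  have "X v \<longleftrightarrow> X1 (sat v f) v" for v
    using insert.prems(2) unfolding X1_def by (metis insert_iff)
  then have "X v \<longleftrightarrow> sat v f \<and> X1 True v \<or> \<not> sat v f \<and> X1 False v" for v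
    by (cases "sat v f") simp_all
  with \<gamma> insert.prems(1) show ?case
    by (intro exI[of _ "Or (And f (\<gamma> True)) (And (Neg f) (\<gamma> False))"]) simp
qed

definition lin_tm :: "nat list \<Rightarrow> (nat \<Rightarrow> int) \<Rightarrow> int \<Rightarrow> tm" where
  "lin_tm xs a c = foldr (\<lambda>i. Add (Mul (a i) (Var i))) xs (Cst c)"

lemma lin_tm:
  assumes "distinct xs"
  shows "var_coeff (lin_tm xs a c) i = (if i \<in> set xs then a i else 0)"
    and "nf_const (lin_tm xs a c) = c"
    and "eval v (lin_tm xs a c) = lin (set xs) a v + c"
  using assms by (induction xs) (auto simp: lin_tm_def lin_def)

text \<open>The constants \<open>r\<close> up to \<open>P\<close> cover all remainders modulo every
  \<open>k \<le> P\<close>.\<close>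

definition atoms :: "nat set \<Rightarrow> nat \<Rightarrow> int \<Rightarrow> fm set" where
  "atoms V P C =
     (\<lambda>(a, c). Less (lin_tm (sorted_list_of_set V) a c) (Cst 0)) `
       ({a. \<forall>i. (i \<in> V \<longrightarrow> a i \<in> {- int P..int P}) \<and> (i \<notin> V \<longrightarrow> a i = 0)} \<times> {- C..C}) \<union>
     (\<lambda>(i, k, r). Congr k (Var i) (Cst r)) ` (V \<times> {1..P} \<times> {0..int P})"

lemma finite_atoms:
  assumes "finite V"
  shows "finite (atoms V P C)"
proof -
  have "finite {a. \<forall>i. (i \<in> V \<longrightarrow> a i \<in> {- int P..int P}) \<and> (i \<notin> V \<longrightarrow> a i = 0)}"
    using assms by (intro finite_set_of_finite_funs) auto
  then show ?thesis using assms unfolding atoms_def by blast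
qed

lemma atoms_fit:
  assumes "finite V" "f \<in> atoms V P C"
  shows "boolean_combination f \<and> fits P C f"
  using assms by (auto simp: atoms_def Sub_def lin_tm abs_le_iff minus_le_iff)

lemma indist_if_atoms:
  assumes V: "finite V" and eq: "\<forall>f\<in>atoms V P C. sat v f \<longleftrightarrow> sat v' f"
  shows "indist V P C v v'"
  unfolding indist_def
proof (intro conjI allI impI ballI; (elim conjE)?)
  fix a c assume ac: "\<forall>i\<in>V. \<bar>a i\<bar> \<le> int P" "\<bar>c\<bar> \<le> C"
  \<comment> \<open>The atoms use coefficient functions that vanish outside \<open>V\<close>;
    cutting \<open>a\<close> down to \<open>V\<close> leaves \<open>lin V a\<close>
    unchanged.\<close>
  define b where "b i = (if i \<in> V then a i else 0)" for i
  have "Less (lin_tm (sorted_list_of_set V) b c) (Cst 0) \<in> atoms V P C"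
    using ac by (auto simp: atoms_def b_def abs_le_iff intro!: image_eqI[of _ _ "(b, c)"])
  with eq have "lin V b v + c < 0 \<longleftrightarrow> lin V b v' + c < 0"
    using V by (auto simp: lin_tm)
  moreover have "lin V b u = lin V a u" for u
    unfolding lin_def b_def by (intro sum.cong) auto
  ultimately show "lin V a v + c < 0 \<longleftrightarrow> lin V a v' + c < 0" by simp
next
  fix i k assume i: "i \<in> V" and k: "k \<in> {1..P}"
  then have "v i mod int k < int k" by simp
  moreover have "int k \<le> int P" using k by simp
  ultimately have "v i mod int k \<le> int P" by linarith
  \<comment> \<open>With its own remainder as constant, \<open>v\<close> satisfies this atom, hence
    so does \<open>v'\<close>.\<close>
  then have "Congr k (Var i) (Cst (v i mod int k)) \<in> atoms V P C"
    using i k by (auto simp: atoms_def intro!: image_eqI[of _ _ "(i, k, v i mod int k)"])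
  with eq have "[v i = v i mod int k] (mod int k) \<longleftrightarrow> [v' i = v i mod int k] (mod int k)"
    by fastforce
  then show "[v i = v' i] (mod int k)" by (simp add: cong_def)
qed

theorem theorem4p9:
  fixes \<phi> :: fm and d :: nat
  assumes "FO_mod \<phi>" and "qdepth \<phi> = d"
  shows "\<exists>\<gamma>. boolean_combination \<gamma> \<and> equivalent \<gamma> \<phi>
    \<and> Max (Params \<gamma>) \<le> Max (Params \<phi>) ^ (4 ^ d)
    \<and> Max (Const \<gamma>) \<le> 2 ^ nat (Max (Params \<phi>) ^ (4 ^ d)) * Max (Const \<phi>)"
proof -
  define P where "P = nat (Max (Params \<phi>))"
  define C where "C = Max (Const \<phi>)"
  define V where "V = fm_vars \<phi>"
  have V: "finite V" by (simp add: V_def finite_fm_vars)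
  have P: "2 \<le> P" "int P = Max (Params \<phi>)" using Max_Params_ge[of \<phi>] by (auto simp: P_def)
  have C: "2 \<le> C" using Max_Const_ge[of \<phi>] by (simp add: C_def)
  have fits: "fits P C \<phi>" using P C by (simp add: fits_iff_Max C_def)
  define Q where "Q = P ^ 4 ^ d"
  define D where "D = 2 ^ Q * C"
  have Q: "2 \<le> Q" using P(1) self_le_power[of P "4 ^ d"] by (simp add: Q_def)
  have "1 * C \<le> D" unfolding D_def using C by (intro mult_right_mono) auto
  with C have D: "2 \<le> D" by simp
  have "\<exists>\<gamma>. boolean_combination \<gamma> \<and> fits Q D \<gamma> \<and> (\<forall>v. sat v \<gamma> \<longleftrightarrow> sat v \<phi>)"
  \<comment> \<open>The property \<open>X\<close> is the truth of the given formula, which by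
    \<open>indist_sat\<close> depends only on the atoms at level \<open>(Q, D)\<close>.\<close>
  proof (rule boolean_combination_of_atoms[of "atoms V Q D"])
    fix v v' assume "\<forall>f\<in>atoms V Q D. sat v f \<longleftrightarrow> sat v' f"
    with V have "indist V Q D v v'" by (rule indist_if_atoms)
    then show "sat v \<phi> \<longleftrightarrow> sat v' \<phi>"
      using indist_sat[OF V P(1) C assms(1) fits, of d] assms(2) by (simp add: V_def Q_def D_def)
  qed (use V D in \<open>auto simp: finite_atoms dest: atoms_fit\<close>)
  then obtain \<gamma> where "boolean_combination \<gamma>" "fits Q D \<gamma>" "\<forall>v. sat v \<gamma> \<longleftrightarrow> sat v \<phi>"
    by blast
  moreover have "int Q = Max (Params \<phi>) ^ 4 ^ d" by (simp add: Q_def P(2))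
  ultimately show ?thesis
    using Q D by (auto simp: equivalent_def fits_iff_Max D_def C_def simp flip: \<open>int Q = _\<close>)
qed

end
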